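(* Let $0<q\le1$, let $\alpha\in\mathbb{D}$, let $\phi_\alpha(z)=\frac{z-\alpha}{1-\overline{\alpha}z}$, and let $C_{\phi_\alpha}$ be the composition operator $C_{\phi_\alpha}f=f\circ\phi_\alpha$ on $H^2(\mathbb{D})$. Then the $q$-Berezin range $\mathrm{Ber}_q(C_{\phi_\alpha})$ is convex if and only if $\alpha=0$.
   Context: $\mathbb{D}$ is the open unit disc in $\mathbb{C}$. $H^2(\mathbb{D})$ is the Hardy space of analytic functions $\sum_{n\ge0}a_nz^n$ on $\mathbb{D}$ with $\sum|a_n|^2<\infty$ and inner product $\langle\sum a_nz^n,\sum b_nz^n\rangle=\sum a_n\overline{b_n}$. Its reproducing kernel at $w\in\mathbb{D}$ is $k_w(z)=\frac{1}{1-\overline{w}z}$, and $\hat{k}_w=k_w/\|k_w\|$. For a bounded linear operator $T$ on $H^2(\mathbb{D})$ and $0<q\le1$, the $q$-Berezin range is $\mathrm{Ber}_q(T)=\{\langle T\hat{k}_{w_1},\hat{k}_{w_2}\rangle: w_1,w_2\in\mathbb{D},\ \langle\hat{k}_{w_1},\hat{k}_{w_2}\rangle=q\}$. *)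

theory Defs
  imports "HOL-Complex_Analysis.Complex_Analysis" "HOL-Library.FuncSet"
begin

text \<open>
  Functions on the open unit disc are represented by total functions \<^typ>\<open>complex \<Rightarrow> complex\<close>;
  values outside \<^term>\<open>ball 0 1 :: complex set\<close> are irrelevant, as everything below depends only
  on the Taylor coefficients at 0.
\<close>

abbreviation taylor_coeff :: "(complex \<Rightarrow> complex) \<Rightarrow> nat \<Rightarrow> complex" where
  "taylor_coeff f n \<equiv> fps_nth (fps_expansion f 0) n"

definition hardy2 :: "(complex \<Rightarrow> complex) set" where
  "hardy2 = {f. f holomorphic_on ball 0 1 \<and> summable (\<lambda>n. (cmod (taylor_coeff f n))\<^sup>2)}"

definition hardy2_inner :: "(complex \<Rightarrow> complex) \<Rightarrow> (complex \<Rightarrow> complex) \<Rightarrow> complex" where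
  "hardy2_inner f g = (\<Sum>n. taylor_coeff f n * cnj (taylor_coeff g n))"

definition hardy2_norm :: "(complex \<Rightarrow> complex) \<Rightarrow> real" where
  "hardy2_norm f = sqrt (Re (hardy2_inner f f))"

definition szego_kernel :: "complex \<Rightarrow> complex \<Rightarrow> complex" where
  "szego_kernel w z = 1 / (1 - cnj w * z)"

definition normalized_kernel :: "complex \<Rightarrow> complex \<Rightarrow> complex" where
  "normalized_kernel w z = szego_kernel w z / complex_of_real (hardy2_norm (szego_kernel w))"

text \<open>
  Defined for an arbitrary map \<open>T\<close>; it is meant for bounded linear operators on \<^const>\<open>hardy2\<close>.
\<close>

definition q_berezin_range ::
    "real \<Rightarrow> ((complex \<Rightarrow> complex) \<Rightarrow> (complex \<Rightarrow> complex)) \<Rightarrow> complex set" where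
  "q_berezin_range q T =
     {hardy2_inner (T (normalized_kernel w1)) (normalized_kernel w2) | w1 w2.
        w1 \<in> ball 0 1 \<and> w2 \<in> ball 0 1 \<and>
        hardy2_inner (normalized_kernel w1) (normalized_kernel w2) = complex_of_real q}"

definition composition_operator ::
    "(complex \<Rightarrow> complex) \<Rightarrow> (complex \<Rightarrow> complex) \<Rightarrow> (complex \<Rightarrow> complex)" where
  "composition_operator \<phi> = (\<lambda>f\<in>hardy2. f \<circ> \<phi>)"

definition disc_automorphism :: "complex \<Rightarrow> complex \<Rightarrow> complex" where
  "disc_automorphism \<alpha> z = (z - \<alpha>) / (1 - cnj \<alpha> * z)"

end

theory Submission
  imports Defs
begin

text \<open>
  The constraint on \<^term>\<open>w1\<close>, \<^term>\<open>w2\<close> forces \<^term>\<open>cnj w1 * w2\<close> to be real, so both points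
  lie on one diameter: \<^term>\<open>w2 = r * u\<close> and \<^term>\<open>w1 = s * u\<close> with \<^term>\<open>cmod u = 1\<close> and real
  \<^term>\<open>r\<close>, \<^term>\<open>s\<close>. With \<^term>\<open>b = cnj \<alpha> * u\<close> the corresponding element of the range is
  \<^term>\<open>q * (1 - r * s) * (1 - r * b) / ((1 - r * s) - r * b + s * cnj b)\<close>.
  If \<^term>\<open>\<alpha> \<noteq> 0\<close>, real elements of the range are bounded below by a positive constant. On the
  diameter orthogonal to \<^term>\<open>\<alpha>\<close>, however, replacing \<^term>\<open>u\<close> by \<^term>\<open>- u\<close> conjugates the element,
  and the elements tend to 0 as \<^term>\<open>r\<close> tends to 1. Midpoints of conjugate pairs would be
  arbitrarily small real elements of a convex range.
\<close>

section \<open>Szego kernels and the reproducing property\<close>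

lemma one_minus_mult_nonzero:
  fixes z w :: complex
  assumes "cmod w < 1" "cmod z < 1"
  shows "1 - w * z \<noteq> 0"
proof
  assume "1 - w * z = 0"
  then have "cmod w * cmod z = 1"
    by (metis eq_iff_diff_eq_0 norm_mult norm_one)
  moreover have "cmod w * cmod z \<le> cmod w"
    using assms by (simp add: mult_left_le)
  ultimately show False using assms by linarith
qed

lemma one_minus_mult_pos:
  fixes r s :: real
  assumes "\<bar>r\<bar> < 1" "\<bar>s\<bar> < 1"
  shows "0 < 1 - r * s"
  using assms abs_mult_less[of r 1 s 1] by (simp add: abs_mult[symmetric] abs_less_iff)

lemma taylor_coeff_geometric: "taylor_coeff (\<lambda>z. c / (1 - b * z)) n = c * b ^ n"
proof -
  have "(\<lambda>z. c / (1 - b * z)) has_fps_expansion fps_const c / (1 - fps_const b * fps_X)"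
    by (intro fps_expansion_intros) auto
  then have "fps_expansion (\<lambda>z. c / (1 - b * z)) 0 = fps_const c / (1 - fps_const b * fps_X)"
    by (rule fps_expansion_eqI)
  also have "\<dots> = fps_const c * Abs_fps (\<lambda>n. b ^ n)"
  proof -
    have "(1 - fps_const b * fps_X) * Abs_fps (\<lambda>n. b ^ n) = 1"
      by (rule fps_ext) (simp add: left_diff_distrib mult.assoc power_eq_if)
    then have "inverse (1 - fps_const b * fps_X) = Abs_fps (\<lambda>n. b ^ n)"
      by (rule fps_inverse_unique)
    then show ?thesis by (simp add: fps_divide_unit)
  qed
  finally show ?thesis by simp
qed

text \<open>The reproducing property: the kernel has coefficients \<open>c * cnj w ^ n\<close>, so
  conjugation turns the inner product into the Taylor series of \<open>f\<close> at
  \<open>w\<close>, times \<open>cnj c\<close>.\<close>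

lemma hardy2_inner_geometric:
  assumes "f holomorphic_on ball 0 1" "cmod w < 1"
  shows "hardy2_inner f (\<lambda>z. c / (1 - cnj w * z)) = f w * cnj c"
proof -
  have "(\<lambda>n. taylor_coeff f n * w ^ n * cnj c) sums (f w * cnj c)"
    using holomorphic_power_series[OF assms(1), of w] assms(2)
    by (intro sums_mult2) (simp add: fps_expansion_def)
  then show ?thesis
    unfolding hardy2_inner_def taylor_coeff_geometric by (simp add: sums_iff ac_simps)
qed

lemma geometric_holomorphic:
  assumes "cmod w < 1"
  shows "(\<lambda>z. c / (1 - cnj w * z)) holomorphic_on ball 0 1"
  using one_minus_mult_nonzero[of "cnj w"] assms by (intro holomorphic_intros) auto

lemma hardy2_norm_szego_kernel:
  assumes "cmod w < 1"
  shows "hardy2_norm (szego_kernel w) = 1 / sqrt (1 - (cmod w)\<^sup>2)"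
proof -
  have "hardy2_inner (szego_kernel w) (szego_kernel w) = 1 / (1 - cnj w * w)"
    using hardy2_inner_geometric[OF geometric_holomorphic, OF assms assms, of 1 1]
    by (simp add: szego_kernel_def[abs_def])
  also have "\<dots> = complex_of_real (1 / (1 - (cmod w)\<^sup>2))"
    using complex_norm_square[of w] by (simp add: mult.commute)
  finally show ?thesis
    by (simp add: hardy2_norm_def real_sqrt_divide del: of_real_divide of_real_diff)
qed

lemma normalized_kernel_eq:
  assumes "cmod w < 1"
  shows "normalized_kernel w = (\<lambda>z. complex_of_real (sqrt (1 - (cmod w)\<^sup>2)) / (1 - cnj w * z))"
  using assms
  by (simp add: fun_eq_iff normalized_kernel_def szego_kernel_def hardy2_norm_szego_kernel)

lemma hardy2_inner_normalized_kernel: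
  assumes "f holomorphic_on ball 0 1" "cmod w < 1"
  shows "hardy2_inner f (normalized_kernel w) = f w * sqrt (1 - (cmod w)\<^sup>2)"
  using assms by (simp add: normalized_kernel_eq hardy2_inner_geometric)

text \<open>\<open>composition_operator\<close> is a function restricted to \<open>hardy2\<close>,
  so membership is what allows its application to a kernel to be unfolded.\<close>

lemma normalized_kernel_in_hardy2:
  assumes "cmod w < 1"
  shows "normalized_kernel w \<in> hardy2"
proof -
  have "(cmod w)\<^sup>2 < 1"
    using assms by (simp add: abs_square_less_1)
  then have "summable (\<lambda>n. (1 - (cmod w)\<^sup>2) * ((cmod w)\<^sup>2) ^ n)"
    by (intro summable_mult summable_geometric) simp
  moreover have "(cmod (taylor_coeff (normalized_kernel w) n))\<^sup>2
      = (1 - (cmod w)\<^sup>2) * ((cmod w)\<^sup>2) ^ n" for n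
    using \<open>(cmod w)\<^sup>2 < 1\<close>
    by (simp add: normalized_kernel_eq[OF assms] taylor_coeff_geometric norm_mult norm_power
        power_mult_distrib flip: power_mult) (simp add: mult.commute)
  ultimately show ?thesis
    using geometric_holomorphic[OF assms] by (simp add: hardy2_def normalized_kernel_eq[OF assms])
qed

section \<open>Inner products of kernels before and after composition\<close>

lemma disc_automorphism_eq_Moebius: "disc_automorphism \<alpha> = Moebius_function 0 \<alpha>"
  by (simp add: fun_eq_iff disc_automorphism_def Moebius_function_simple)

lemma hardy2_inner_normalized_kernels:
  assumes "cmod w < 1" "cmod z < 1"
  shows "hardy2_inner (normalized_kernel w) (normalized_kernel z)
    = complex_of_real (sqrt (1 - (cmod w)\<^sup>2) * sqrt (1 - (cmod z)\<^sup>2)) / (1 - cnj w * z)"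
  using assms geometric_holomorphic[OF assms(1)]
  by (simp add: hardy2_inner_normalized_kernel normalized_kernel_eq[OF assms(1)])

lemma hardy2_inner_composition_kernel:
  assumes "cmod w < 1" "cmod z < 1" "cmod \<alpha> < 1"
  shows "hardy2_inner (composition_operator (disc_automorphism \<alpha>) (normalized_kernel w))
      (normalized_kernel z)
    = complex_of_real (sqrt (1 - (cmod w)\<^sup>2) * sqrt (1 - (cmod z)\<^sup>2))
      / (1 - cnj w * disc_automorphism \<alpha> z)"
proof -
  let ?\<phi> = "disc_automorphism \<alpha>"
  have "?\<phi> holomorphic_on ball 0 1" "?\<phi> ` ball 0 1 \<subseteq> ball 0 1"
    using assms(3) Moebius_function_holomorphic Moebius_function_norm_lt_1
    by (auto simp: disc_automorphism_eq_Moebius)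
  moreover have "normalized_kernel w holomorphic_on ball 0 1"
    using geometric_holomorphic[OF assms(1)] by (simp add: normalized_kernel_eq[OF assms(1)])
  ultimately have "(normalized_kernel w \<circ> ?\<phi>) holomorphic_on ball 0 1"
    by (blast intro: holomorphic_on_compose_gen)
  then show ?thesis
    using assms normalized_kernel_in_hardy2[OF assms(1)]
    by (simp add: composition_operator_def hardy2_inner_normalized_kernel)
      (simp add: normalized_kernel_eq[OF assms(1)])
qed

section \<open>Reduction to pairs of points on a diameter\<close>

text \<open>The factor \<open>q * (1 - r * s)\<close> stands for the product of the two square
  roots, which it equals under the constraint; this makes the value rational in \<open>r\<close>,
  \<open>s\<close>, \<open>b\<close> and \<open>cnj b\<close>.\<close>

definition berezin_value :: "real \<Rightarrow> real \<Rightarrow> real \<Rightarrow> complex \<Rightarrow> complex" where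
  "berezin_value q r s b =
     q * (1 - r * s) * (1 - r * b) / ((1 - r * s) - r * b + s * cnj b)"

lemma inner_composition_kernel_diameter:
  assumes "\<bar>r\<bar> < 1" "\<bar>s\<bar> < 1" "cmod u = 1" "cmod \<alpha> < 1"
    and "q * (1 - r * s) = sqrt (1 - s\<^sup>2) * sqrt (1 - r\<^sup>2)"
  shows "hardy2_inner
      (composition_operator (disc_automorphism \<alpha>) (normalized_kernel (of_real s * u)))
      (normalized_kernel (of_real r * u)) = berezin_value q r s (cnj \<alpha> * u)"
proof -
  have uu: "cnj u * u = 1"
    using assms(3) complex_norm_square[of u] by (simp add: mult.commute)
  have nz: "1 - cnj \<alpha> * (r * u) \<noteq> 0"
    using assms by (intro one_minus_mult_nonzero) (auto simp: norm_mult)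
  have "cnj (s * u) * (r * u - \<alpha>) = r * s * (cnj u * u) - s * (\<alpha> * cnj u)"
    by (simp add: algebra_simps)
  also have "\<dots> = r * s - s * (\<alpha> * cnj u)"
    by (simp add: uu)
  finally have num: "cnj (s * u) * (r * u - \<alpha>) = r * s - s * (\<alpha> * cnj u)" .
  have quot: "1 - cnj (s * u) * disc_automorphism \<alpha> (r * u)
      = (1 - cnj \<alpha> * (r * u) - cnj (s * u) * (r * u - \<alpha>)) / (1 - cnj \<alpha> * (r * u))"
    using nz by (simp add: disc_automorphism_def diff_divide_distrib[of "1 - cnj \<alpha> * (r * u)"])
  have "1 - cnj (s * u) * disc_automorphism \<alpha> (r * u)
      = ((1 - r * s) - r * (cnj \<alpha> * u) + s * cnj (cnj \<alpha> * u)) / (1 - cnj \<alpha> * (r * u))"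
    unfolding quot num by (simp add: algebra_simps)
  moreover have "cmod (s * u) = \<bar>s\<bar>" "cmod (r * u) = \<bar>r\<bar>"
    using assms(3) by (auto simp: norm_mult)
  ultimately show ?thesis
    using assms hardy2_inner_composition_kernel[of "s * u" "r * u" \<alpha>]
    by (simp add: berezin_value_def flip: assms(5))
qed

lemma inner_kernel_diameter_eq_iff:
  assumes "\<bar>r\<bar> < 1" "\<bar>s\<bar> < 1" "cmod u = 1"
  shows "hardy2_inner (normalized_kernel (of_real s * u)) (normalized_kernel (of_real r * u))
      = complex_of_real q \<longleftrightarrow> q * (1 - r * s) = sqrt (1 - s\<^sup>2) * sqrt (1 - r\<^sup>2)"
proof -
  have uu: "cnj u * u = 1"
    using assms(3) complex_norm_square[of u] by (simp add: mult.commute)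
  have n: "cmod (s * u) = \<bar>s\<bar>" "cmod (r * u) = \<bar>r\<bar>"
    using assms(3) by (auto simp: norm_mult)
  have "cnj (s * u) * (r * u) = r * s * (cnj u * u)"
    by (simp add: algebra_simps)
  then have e: "1 - cnj (s * u) * (r * u) = complex_of_real (1 - r * s)"
    by (simp add: uu)
  have "1 - r * s \<noteq> 0"
    using one_minus_mult_pos[OF assms(1,2)] by simp
  then show ?thesis
    using assms n hardy2_inner_normalized_kernels[of "s * u" "r * u"]
    unfolding e of_real_divide[symmetric] of_real_eq_iff
    by (auto simp: field_simps simp flip: of_real_divide)
qed

text \<open>The direction \<open>u\<close> is \<open>sgn z\<close> if \<open>z\<close> is nonzero,
  otherwise \<open>sgn w\<close>, and 1 if both vanish.\<close>

lemma collinear_real_multiples: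
  fixes z w :: complex
  assumes "Im (cnj w * z) = 0"
  obtains u r s where "cmod u = 1" "z = of_real r * u" "w = of_real s * u"
proof (cases "z = 0")
  case True
  show thesis
  proof (cases "w = 0")
    case True
    with \<open>z = 0\<close> show thesis using that[of 1 0 0] by simp
  next
    case False
    then have "cmod (sgn w) = 1" "w = of_real (cmod w) * sgn w"
      by (simp_all add: norm_sgn) (simp add: sgn_eq)
    then show thesis
      using that[of "sgn w" 0 "cmod w"] \<open>z = 0\<close> by simp
  qed
next
  case False
  have "cnj w * z = complex_of_real (Re (cnj w * z))"
    using assms by (simp add: complex_eq_iff)
  then have "w * cnj z = complex_of_real (Re (cnj w * z))"
    by (metis complex_cnj_cnj complex_cnj_complex_of_real complex_cnj_mult)
  \<comment> \<open>Multiplying by \<open>z\<close> isolates \<open>w\<close>, because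
    \<open>z * cnj z\<close> is a positive real.\<close>
  then have "w * (z * cnj z) = complex_of_real (Re (cnj w * z)) * z"
    by (metis mult.commute mult.left_commute)
  then have "w = complex_of_real (Re (cnj w * z) / cmod z) * sgn z"
    using False
    by (simp add: sgn_eq field_simps power2_eq_square flip: complex_norm_square)
  moreover have "cmod (sgn z) = 1" "z = of_real (cmod z) * sgn z"
    using False by (simp_all add: norm_sgn) (simp add: sgn_eq)
  ultimately show thesis using that by blast
qed

lemma q_berezin_range_composition_eq:
  assumes "0 < q" "cmod \<alpha> < 1"
  shows "q_berezin_range q (composition_operator (disc_automorphism \<alpha>)) =
    {berezin_value q r s (cnj \<alpha> * u) | r s u. \<bar>r\<bar> < 1 \<and> \<bar>s\<bar> < 1 \<and> cmod u = 1 \<and>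
       q * (1 - r * s) = sqrt (1 - s\<^sup>2) * sqrt (1 - r\<^sup>2)}" (is "?L = ?R")
proof
  show "?L \<subseteq> ?R"
  proof
    fix v assume "v \<in> ?L"
    then obtain w z where wz: "cmod w < 1" "cmod z < 1"
      and q: "hardy2_inner (normalized_kernel w) (normalized_kernel z) = complex_of_real q"
      and v: "v = hardy2_inner (composition_operator (disc_automorphism \<alpha>) (normalized_kernel w))
        (normalized_kernel z)"
      by (auto simp: q_berezin_range_def)
    \<comment> \<open>Since \<open>q\<close> is nonzero, the constraint can be solved for
      \<open>1 - cnj w * z\<close>, which is thereby real.\<close>
    have "1 - cnj w * z
        = complex_of_real (sqrt (1 - (cmod w)\<^sup>2) * sqrt (1 - (cmod z)\<^sup>2) / q)"
      using q \<open>0 < q\<close> one_minus_mult_nonzero[of "cnj w" z] wz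
      by (simp add: hardy2_inner_normalized_kernels field_simps)
    then have "Im (1 - cnj w * z) = 0"
      by (metis Im_complex_of_real)
    then have "Im (cnj w * z) = 0" by simp
    then obtain u r s where u: "cmod u = 1" "z = of_real r * u" "w = of_real s * u"
      by (rule collinear_real_multiples)
    then have rs: "\<bar>r\<bar> < 1" "\<bar>s\<bar> < 1"
      using wz by (auto simp: norm_mult)
    with q u have "q * (1 - r * s) = sqrt (1 - s\<^sup>2) * sqrt (1 - r\<^sup>2)"
      by (simp add: inner_kernel_diameter_eq_iff)
    then show "v \<in> ?R"
      using v u rs assms inner_composition_kernel_diameter by blast
  qed
  show "?R \<subseteq> ?L"
  proof
    fix v assume "v \<in> ?R"
    then obtain r s u where *: "\<bar>r\<bar> < 1" "\<bar>s\<bar> < 1" "cmod u = 1"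
      "q * (1 - r * s) = sqrt (1 - s\<^sup>2) * sqrt (1 - r\<^sup>2)"
      and v: "v = berezin_value q r s (cnj \<alpha> * u)"
      by blast
    have "of_real s * u \<in> ball 0 1" "of_real r * u \<in> ball 0 1"
      using * by (auto simp: norm_mult)
    moreover note inner_kernel_diameter_eq_iff[OF *(1-3), THEN iffD2, OF *(4)]
      inner_composition_kernel_diameter[OF *(1-3) assms(2) *(4)]
    ultimately show "v \<in> ?L"
      unfolding q_berezin_range_def v mem_Collect_eq by metis
  qed
qed

lemma berezin_value_0:
  assumes "\<bar>r\<bar> < 1" "\<bar>s\<bar> < 1"
  shows "berezin_value q r s 0 = q"
proof -
  have "complex_of_real (1 - r * s) \<noteq> 0"
    unfolding of_real_eq_0_iff using one_minus_mult_pos[OF assms] by simp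
  then show ?thesis by (simp add: berezin_value_def)
qed

section \<open>Lower bound for the real elements of the range\<close>

text \<open>The value can be real only if \<open>b\<close> is real or \<open>s = 0\<close>. In the
  first case numerator and denominator are estimated separately; in the second they cancel and leave
  \<open>q\<close>.\<close>

lemma berezin_value_real_bound:
  assumes "\<bar>r\<bar> < 1" "\<bar>s\<bar> < 1" "cmod b < 1" "0 < q"
    and real: "Im (berezin_value q r s b) = 0"
  shows "q * (1 - cmod b) / (1 + cmod b) \<le> Re (berezin_value q r s b)"
proof -
  define x y where "x = Re b" and "y = Im b"
  have b: "b = Complex x y" by (simp add: x_def y_def)
  have x: "\<bar>x\<bar> \<le> cmod b" unfolding x_def by (rule abs_Re_le_cmod)
  define t where "t = 1 - r * s"
  have t: "0 < t"
    unfolding t_def using assms(1,2) by (rule one_minus_mult_pos)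
  \<comment> \<open>The two products below expand to \<open>t - (r - s)\<close> and
    \<open>t + (r - s)\<close>.\<close>
  have rs: "\<bar>r - s\<bar> < t"
  proof -
    have "0 < (1 - r) * (1 + s)" "0 < (1 + r) * (1 - s)"
      using assms by (auto intro!: mult_pos_pos)
    then show ?thesis by (auto simp: t_def algebra_simps)
  qed
  have D0: "0 < t - (r - s) * x"
  proof -
    have "(r - s) * x \<le> \<bar>r - s\<bar> * \<bar>x\<bar>"
      by (metis abs_ge_self abs_mult)
    also have "\<dots> \<le> \<bar>r - s\<bar> * 1"
      using x assms(3) by (intro mult_left_mono) auto
    finally show ?thesis using rs by simp
  qed
  have N: "1 - of_real r * b = Complex (1 - r * x) (- (r * y))"
    and D: "1 - of_real r * of_real s - of_real r * b + of_real s * cnj b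
      = Complex (t - (r - s) * x) (- ((r + s) * y))"
    by (simp_all add: b t_def complex_eq_iff algebra_simps)
  have form: "berezin_value q r s b = of_real (q * t) *
      (Complex (1 - r * x) (- (r * y)) / Complex (t - (r - s) * x) (- ((r + s) * y)))"
    by (simp add: berezin_value_def t_def N D)
  have D2: "(t - (r - s) * x)\<^sup>2 + (- ((r + s) * y))\<^sup>2 \<noteq> 0"
    using D0 by (smt (verit) zero_le_power2 zero_less_power2)
  \<comment> \<open>This is the numerator of the imaginary part of the quotient in
    \<open>form\<close>, whose prefactor \<open>q * t\<close> is nonzero. On expansion every term
    without the factor \<open>s\<close> cancels.\<close>
  have "- (r * y) * (t - (r - s) * x) - (1 - r * x) * (- ((r + s) * y)) = 0"
    using real D2 D0 \<open>0 < q\<close> t unfolding form by (auto simp: Im_divide)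
  then have "y * s * (1 + r\<^sup>2 - 2 * r * x) = 0"
    by (simp add: t_def algebra_simps power2_eq_square)
  \<comment> \<open>The expression equals \<open>(r - x)\<^sup>2 + (1 - x\<^sup>2)\<close>.\<close>
  moreover have "1 + r\<^sup>2 - 2 * r * x > 0"
  proof -
    have "x\<^sup>2 < 1" using x assms(3) by (simp add: abs_square_less_1)
    moreover have "0 \<le> (r - x)\<^sup>2" by simp
    ultimately show ?thesis by (simp add: power2_diff)
  qed
  ultimately consider "y = 0" | "s = 0" by auto
  then show ?thesis
  proof cases
    case 1
    have N0: "1 - cmod b \<le> 1 - r * x"
    proof -
      have "r * x \<le> \<bar>r\<bar> * \<bar>x\<bar>"
        by (metis abs_ge_self abs_mult)
      also have "\<dots> \<le> 1 * cmod b"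
        using x assms(1) by (intro mult_mono) auto
      finally show ?thesis by simp
    qed
    have D': "t - (r - s) * x \<le> t * (1 + cmod b)"
    proof -
      have "- ((r - s) * x) \<le> \<bar>r - s\<bar> * \<bar>x\<bar>"
        by (metis abs_ge_minus_self abs_mult)
      also have "\<dots> \<le> t * cmod b"
        using x rs t by (intro mult_mono) auto
      finally show ?thesis by (simp add: algebra_simps)
    qed
    have "q * (1 - cmod b) / (1 + cmod b) = q * t * (1 - cmod b) / (t * (1 + cmod b))"
      using t by simp
    also have "\<dots> \<le> q * t * (1 - r * x) / (t - (r - s) * x)"
      using N0 D0 D' t assms(3,4) by (intro frac_le mult_left_mono mult_nonneg_nonneg) auto
    also have "\<dots> = Re (berezin_value q r s b)"
      using D0 unfolding form 1 by (simp add: Re_divide power2_eq_square)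
    finally show ?thesis .
  next
    case 2
    have "1 - of_real r * b \<noteq> 0"
      using assms by (intro one_minus_mult_nonzero) auto
    then have "Re (berezin_value q r s b) = q"
      by (simp add: berezin_value_def 2)
    then show ?thesis
      using assms(4) by (simp add: pos_divide_le_eq add_pos_nonneg)
  qed
qed

section \<open>Small elements on the orthogonal diameter\<close>

text \<open>Let \<open>r\<close> tend to 1 along the curve cut out by the constraint. Then
  \<open>s\<close> tends to 1 too, so the factor \<open>1 - r * s\<close> tends to 0, while the
  denominator tends to \<open>- 2 * \<i> * a\<close>, which is nonzero.\<close>

lemma ex_berezin_value_small:
  fixes q a e :: real
  assumes "0 < q" "q \<le> 1" "0 < a" "0 < e"
  obtains r s where "\<bar>r\<bar> < 1" "\<bar>s\<bar> < 1"
    "q * (1 - r * s) = sqrt (1 - s\<^sup>2) * sqrt (1 - r\<^sup>2)"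
    "cmod (berezin_value q r s (\<i> * of_real a)) < e"
proof -
  define p where "p = sqrt (1 - q\<^sup>2)"
  have q2: "0 < q\<^sup>2" "q\<^sup>2 \<le> 1" using assms by (auto simp: power_le_one)
  then have p: "0 \<le> p" "p < 1" and p2: "p\<^sup>2 = 1 - q\<^sup>2"
    by (auto simp: p_def)
  \<comment> \<open>The constraint says that \<^term>\<open>r\<close> and \<^term>\<open>s\<close> have pseudohyperbolic distance \<^term>\<open>p\<close>.\<close>
  define S where "S = (\<lambda>r. (r - p) / (1 - r * p))"
  define f where "f = (\<lambda>r. berezin_value q r (S r) (\<i> * of_real a))"
  have "isCont S 1"
    unfolding S_def using p by (intro continuous_intros) auto
  moreover have S1: "S 1 = 1" using p by (simp add: S_def)
  ultimately have "isCont f 1"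
    unfolding f_def berezin_value_def using assms(3)
    by (intro continuous_intros) (auto simp: complex_eq_iff)
  moreover have "f 1 = 0" by (simp add: f_def berezin_value_def S1)
  ultimately have "(f \<longlongrightarrow> 0) (at 1)" by (simp add: isCont_def)
  \<comment> \<open>The approach is from the left so that \<open>r\<close> stays inside the
    disc.\<close>
  then have "(f \<longlongrightarrow> 0) (at_left 1)" by (rule tendsto_within_subset) auto
  then have "\<forall>\<^sub>F r in at_left 1. dist (f r) 0 < e"
    using assms(4) by (rule tendstoD)
  moreover have "\<forall>\<^sub>F r in at_left 1. r \<in> {0<..<1::real}"
    by (rule eventually_at_leftI[of 0]) auto
  ultimately have "\<forall>\<^sub>F r in at_left 1. dist (f r) 0 < e \<and> r \<in> {0<..<1}"
    by (rule eventually_conj)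
  then obtain r where r: "dist (f r) 0 < e" "0 < r" "r < 1"
    using eventually_happens[of _ "at_left (1::real)"] by auto
  have rp: "r * p < 1" using r p by (smt (verit) mult_left_le)
  \<comment> \<open>The usual identity for a disc automorphism, with
    \<open>1 - p\<^sup>2 = q\<^sup>2\<close>. It yields both \<open>\<bar>S r\<bar> < 1\<close> and,
    after taking roots, the constraint.\<close>
  have s2: "1 - (S r)\<^sup>2 = (1 - r\<^sup>2) * q\<^sup>2 / (1 - r * p)\<^sup>2"
  proof -
    have "1 - (S r)\<^sup>2 = ((1 - r * p)\<^sup>2 - (r - p)\<^sup>2) / (1 - r * p)\<^sup>2"
      using rp by (simp add: S_def power_divide field_simps)
    also have "(1 - r * p)\<^sup>2 - (r - p)\<^sup>2 = (1 - r\<^sup>2) * (1 - p\<^sup>2)"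
      by (simp add: power2_eq_square algebra_simps)
    finally show ?thesis by (simp add: p2)
  qed
  have r2: "r\<^sup>2 < 1" using r by (simp add: abs_square_less_1)
  show thesis
  proof (rule that)
    show "\<bar>r\<bar> < 1" using r by simp
    have "0 < 1 - (S r)\<^sup>2" unfolding s2 using r2 q2 rp by simp
    then show "\<bar>S r\<bar> < 1" by (simp add: abs_square_less_1)
    have "sqrt (1 - (S r)\<^sup>2) * sqrt (1 - r\<^sup>2) = q * (1 - r\<^sup>2) / (1 - r * p)"
      unfolding s2 using r2 rp assms(1) by (simp add: real_sqrt_mult real_sqrt_divide)
    also have "\<dots> = q * (1 - r * S r)"
      using rp by (simp add: S_def field_simps power2_eq_square)
    finally show "q * (1 - r * S r) = sqrt (1 - (S r)\<^sup>2) * sqrt (1 - r\<^sup>2)" by simp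
    show "cmod (berezin_value q r (S r) (\<i> * of_real a)) < e"
      using r by (simp add: f_def)
  qed
qed

section \<open>Convexity of the range\<close>

theorem theorem3p26:
  fixes q :: real and \<alpha> :: complex
  assumes "0 < q" and "q \<le> 1" and "\<alpha> \<in> ball 0 1"
  shows "convex (q_berezin_range q (composition_operator (disc_automorphism \<alpha>))) \<longleftrightarrow> \<alpha> = 0"
    (is "convex ?B \<longleftrightarrow> _")
proof
  have \<alpha>: "cmod \<alpha> < 1" using assms(3) by simp
  note B = q_berezin_range_composition_eq[OF assms(1) \<alpha>]
  {
    assume "\<alpha> = 0"
    then have "?B \<subseteq> {of_real q}"
      unfolding B by (auto simp: berezin_value_0)
    then show "convex ?B"
      \<comment> \<open>A subset of a singleton is empty or the singleton itself, and both are
        convex.\<close>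
      by (metis convex_empty convex_singleton subset_singletonD)
  next
    assume "convex ?B"
    show "\<alpha> = 0"
    proof (rule ccontr)
      assume "\<alpha> \<noteq> 0"
      define a where "a = cmod \<alpha>"
      have a: "0 < a" "a < 1" using \<open>\<alpha> \<noteq> 0\<close> \<alpha> by (auto simp: a_def)
      \<comment> \<open>The bound from \<open>berezin_value_real_bound\<close>; it involves
        \<open>b\<close> only through its modulus, so it is the same on every diameter.\<close>
      define m where "m = q * (1 - a) / (1 + a)"
      have "0 < m" using a assms(1) by (simp add: m_def)
      with assms a obtain r s where rs: "\<bar>r\<bar> < 1" "\<bar>s\<bar> < 1"
        "q * (1 - r * s) = sqrt (1 - s\<^sup>2) * sqrt (1 - r\<^sup>2)"
        and small: "cmod (berezin_value q r s (\<i> * of_real a)) < m"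
        by (metis ex_berezin_value_small)
      let ?v = "berezin_value q r s (\<i> * of_real a)"
      \<comment> \<open>These two directions, orthogonal to \<open>\<alpha>\<close>, make
        \<open>b\<close> purely imaginary, so that changing the sign of \<open>b\<close> is
        conjugation.\<close>
      have u: "cmod (\<i> * sgn \<alpha>) = 1" "cmod (- (\<i> * sgn \<alpha>)) = 1"
        using \<open>\<alpha> \<noteq> 0\<close> by (auto simp: norm_mult norm_sgn)
      have "cnj \<alpha> * sgn \<alpha> = of_real a"
        using \<open>\<alpha> \<noteq> 0\<close> complex_norm_square[of \<alpha>]
        by (simp add: sgn_eq a_def field_simps power2_eq_square)
      then have ca: "cnj \<alpha> * (\<i> * sgn \<alpha>) = \<i> * of_real a"
        "cnj \<alpha> * (- (\<i> * sgn \<alpha>)) = - (\<i> * of_real a)"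
        by (auto simp: mult.left_commute)
      have "?v \<in> ?B"
        unfolding B using rs u(1) ca(1) by (metis (mono_tags, lifting) mem_Collect_eq)
      moreover have "berezin_value q r s (- (\<i> * of_real a)) \<in> ?B"
        unfolding B using rs u(2) ca(2) by (metis (mono_tags, lifting) mem_Collect_eq)
      moreover have "berezin_value q r s (- (\<i> * of_real a)) = cnj ?v"
        by (simp add: berezin_value_def)
      ultimately have "(1/2) *\<^sub>R ?v + (1/2) *\<^sub>R cnj ?v \<in> ?B"
        using convexD[OF \<open>convex ?B\<close>, of ?v "cnj ?v" "1/2" "1/2"] by simp
      moreover have "(1/2) *\<^sub>R ?v + (1/2) *\<^sub>R cnj ?v = of_real (Re ?v)"
        by (simp add: complex_eq_iff)
      ultimately have "complex_of_real (Re ?v) \<in> ?B" by simp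
      \<comment> \<open>The real midpoint may arise from a different diameter and different
        parameters; the lower bound \<open>m\<close> still applies to it.\<close>
      then obtain r' s' u' where *: "\<bar>r'\<bar> < 1" "\<bar>s'\<bar> < 1" "cmod u' = 1"
        and v: "complex_of_real (Re ?v) = berezin_value q r' s' (cnj \<alpha> * u')"
        unfolding B by blast
      have "cmod (cnj \<alpha> * u') = a" using * by (simp add: norm_mult a_def)
      then have "m \<le> Re ?v"
        using berezin_value_real_bound[OF *(1,2), of "cnj \<alpha> * u'" q] a assms(1)
        by (simp add: m_def flip: v)
      with small complex_Re_le_cmod[of ?v] show False by linarith
    qed
  }
qed

end
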